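(* Let $d\ge 1$. The arcsine transformations $\mathcal{A}_1$ and $\mathcal{A}_2$ of measures on $\mathbb{R}^d$ have the same range: $\mathfrak{R}(\mathcal{A}_1)=\mathfrak{R}(\mathcal{A}_2)$.
   Context: $\mathfrak{M}_L(\mathbb{R}^d)$ is the class of Lévy measures on $\mathbb{R}^d$: measures $\nu$ with $\nu(\{0\})=0$ and $\int_{\mathbb{R}^d}(1\wedge|x|^2)\,\nu(\mathrm{d}x)<\infty$. For $s>0$ let $a_1(r;s)=2\pi^{-1}(s-r^2)^{-1/2}1_{(0,s^{1/2})}(r)$ and $a_2(r;s)=a_1(r;s^2)=2\pi^{-1}(s^2-r^2)^{-1/2}1_{(0,s)}(r)$. For $i=1,2$ and a measure $\nu$ on $\mathbb{R}^d$ define $$\mathcal{A}_i(\nu)(B)=\int_{\mathbb{R}^d\setminus\{0\}}\nu(\mathrm{d}x)\int_0^\infty a_i(r;|x|)\,1_B\!\left(r\frac{x}{|x|}\right)\mathrm{d}r,\qquad B\in\mathcal{B}(\mathbb{R}^d).$$ The domain $\mathfrak{D}(\mathcal{A}_i)$ is the class of measures $\nu$ on $\mathbb{R}^d$ such that $\nu(\{0\})=0$ and the right-hand side, as a function of $B$, is a measure belonging to $\mathfrak{M}_L(\mathbb{R}^d)$; the range is $\mathfrak{R}(\mathcal{A}_i)=\{\mathcal{A}_i(\nu):\nu\in\mathfrak{D}(\mathcal{A}_i)\}$. *)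

theory Defs
  imports "HOL-Analysis.Analysis"
begin

definition levy_measures :: "'a::euclidean_space measure set" where
  "levy_measures = {\<nu>. sets \<nu> = sets borel \<and> emeasure \<nu> {0} = 0 \<and>
     (\<integral>\<^sup>+x. ennreal (min 1 ((norm x)\<^sup>2)) \<partial>\<nu>) < \<infinity>}"

text \<open>The arcsine densities are meant for a parameter \<open>s > 0\<close> only; outside the indicated
  interval the indicator annihilates the (then meaningless) value of \<open>powr\<close>.\<close>

definition a1 :: "real \<Rightarrow> real \<Rightarrow> real" where
  "a1 r s = 2 / pi * (s - r\<^sup>2) powr (- 1 / 2) * indicator {0<..<sqrt s} r"

definition a2 :: "real \<Rightarrow> real \<Rightarrow> real" where
  "a2 r s = 2 / pi * (s\<^sup>2 - r\<^sup>2) powr (- 1 / 2) * indicator {0<..<s} r"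

lemma a2_eq_a1: "s > 0 \<Longrightarrow> a2 r s = a1 r (s\<^sup>2)"
  by (simp add: a1_def a2_def)

definition arcsine_fun ::
    "(real \<Rightarrow> real \<Rightarrow> real) \<Rightarrow> 'a::euclidean_space measure \<Rightarrow> 'a set \<Rightarrow> ennreal" where
  "arcsine_fun a \<nu> B =
     (\<integral>\<^sup>+x\<in>- {0}. (\<integral>\<^sup>+r\<in>{0<..}.
        ennreal (a r (norm x)) * indicator B (r *\<^sub>R (x /\<^sub>R norm x)) \<partial>lborel) \<partial>\<nu>)"

definition arcsine_trans ::
    "(real \<Rightarrow> real \<Rightarrow> real) \<Rightarrow> 'a::euclidean_space measure \<Rightarrow> 'a measure" where
  "arcsine_trans a \<nu> = measure_of UNIV (sets borel) (arcsine_fun a \<nu>)"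

text \<open>Since \<open>measure_of\<close> returns the null measure when its argument is not a measure, the domain
  requires explicitly that the set function is one.\<close>

definition arcsine_domain ::
    "(real \<Rightarrow> real \<Rightarrow> real) \<Rightarrow> 'a::euclidean_space measure set" where
  "arcsine_domain a = {\<nu>. sets \<nu> = sets borel \<and> emeasure \<nu> {0} = 0 \<and>
     measure_space UNIV (sets borel) (arcsine_fun a \<nu>) \<and> arcsine_trans a \<nu> \<in> levy_measures}"

definition arcsine_range ::
    "(real \<Rightarrow> real \<Rightarrow> real) \<Rightarrow> 'a::euclidean_space measure set" where
  "arcsine_range a = arcsine_trans a ` arcsine_domain a"

end

theory Submission
  imports Defs
begin

text \<open>
  The two arcsine kernels differ only in how they read the radius: \<open>a2 r s = a1 r (s\<^sup>2)\<close>
  for \<open>s > 0\<close>.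
  Moving every point \<open>x\<close> along its ray from radius \<open>s\<close> to radius \<open>s\<^sup>2\<close> therefore turns the first
  transform into the second one: if \<open>\<nu>'\<close> is the image of \<open>\<nu>\<close> under that map, then the first
  transform of \<open>\<nu>'\<close> is the second transform of \<open>\<nu>\<close>, on every Borel set. Since the two transformed
  set functions are literally equal, \<open>\<nu>'\<close> lies in the domain of the first transform exactly when
  \<open>\<nu>\<close> lies in that of the second, and no integrability has to be checked. The inverse
  map \<open>s \<mapsto> \<surd>s\<close> gives the other inclusion.

  Both inclusions are instances of \<open>arcsine_range_radial_subset\<close>, which rests on the change of
  variables \<open>arcsine_fun_distr_radial_map\<close>.
\<close>

definition radial_map :: "(real \<Rightarrow> real) \<Rightarrow> 'a::real_normed_vector \<Rightarrow> 'a" where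
  "radial_map g x = g (norm x) *\<^sub>R sgn x"

lemma norm_radial_map: "x \<noteq> 0 \<Longrightarrow> g (norm x) > 0 \<Longrightarrow> norm (radial_map g x) = g (norm x)"
  by (simp add: radial_map_def norm_sgn)

lemma sgn_radial_map: "g (norm x) > 0 \<Longrightarrow> sgn (radial_map g x) = sgn x"
  by (cases "x = 0") (simp_all add: radial_map_def sgn_div_norm field_simps)

lemma radial_map_0 [simp]: "radial_map g 0 = 0"
  by (simp add: radial_map_def)

lemma radial_map_eq_0_iff: "(x \<noteq> 0 \<Longrightarrow> g (norm x) > 0) \<Longrightarrow> radial_map g x = 0 \<longleftrightarrow> x = 0"
  by (cases "x = 0") (auto simp: radial_map_def sgn_zero_iff)

lemma borel_measurable_radial_map [measurable]:
  fixes g :: "real \<Rightarrow> real"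
  assumes [measurable]: "g \<in> borel_measurable borel"
  shows "(radial_map g :: 'a::euclidean_space \<Rightarrow> 'a) \<in> borel_measurable borel"
  unfolding radial_map_def sgn_div_norm by measurable

text \<open>
  The transformation rule for image measures asks for a Borel integrand. The parametrised integral
  here runs over Lebesgue measure, so Tonelli's measurability theorem applies to it although the
  outer measure of \<open>arcsine_fun\<close> can be far from \<open>\<sigma>\<close>-finite.
\<close>

lemma borel_measurable_arcsine_integrand:
  fixes a :: "real \<Rightarrow> real \<Rightarrow> real" and B :: "'a::euclidean_space set"
  assumes [measurable]: "case_prod a \<in> borel_measurable borel" "B \<in> sets borel"
  shows "(\<lambda>x::'a. (\<integral>\<^sup>+r\<in>{0<..}. ennreal (a r (norm x)) *
            indicator B (r *\<^sub>R (x /\<^sub>R norm x)) \<partial>lborel)) \<in> borel_measurable borel"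
proof -
  have [measurable]: "(\<lambda>p::'a \<times> real. a (snd p) (norm (fst p))) \<in> borel_measurable borel"
  proof -
    have "(\<lambda>p::'a \<times> real. case_prod a (snd p, norm (fst p))) \<in> borel_measurable borel"
      by (rule measurable_compose[OF _ assms(1)]) (auto intro!: borel_measurable_continuous_onI continuous_intros)
    then show ?thesis by simp
  qed
  then have [measurable]: "(\<lambda>p. a (snd p) (norm (fst p)))
      \<in> borel_measurable ((borel :: 'a measure) \<Otimes>\<^sub>M lborel)"
    by (simp add: borel_prod[symmetric] cong: measurable_cong_sets sets_pair_measure_cong)
  show ?thesis
    by (rule lborel.borel_measurable_nn_integral) (simp add: split_beta', measurable)
qed

text \<open>
  A radial map keeps \<open>x /\<^sub>R norm x\<close> fixed, so in the inner integral only the second argument of the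
  kernel is affected by the change of variables.
\<close>

lemma arcsine_fun_distr_radial_map:
  fixes \<nu> :: "'a::euclidean_space measure"
  assumes \<nu>: "sets \<nu> = sets borel"
    and a: "case_prod a \<in> borel_measurable borel"
    and g [measurable]: "g \<in> borel_measurable borel"
    and g_pos: "\<And>s. s > 0 \<Longrightarrow> g s > 0"
    and ab: "\<And>r s. s > 0 \<Longrightarrow> b r s = a r (g s)"
    and B: "B \<in> sets borel"
  shows "arcsine_fun a (distr \<nu> borel (radial_map g)) B = arcsine_fun b \<nu> B"
proof -
  note [measurable_cong] = \<nu>
  note [measurable] = borel_measurable_arcsine_integrand[OF a B]
  have "arcsine_fun a (distr \<nu> borel (radial_map g)) B =
     (\<integral>\<^sup>+x. (\<integral>\<^sup>+r\<in>{0<..}. ennreal (a r (norm (radial_map g x :: 'a))) *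
        indicator B (r *\<^sub>R (radial_map g x /\<^sub>R norm (radial_map g x))) \<partial>lborel)
        * indicator (- {0}) (radial_map g x) \<partial>\<nu>)"
    unfolding arcsine_fun_def by (rule nn_integral_distr) measurable
  also have "\<dots> = arcsine_fun b \<nu> B"
    unfolding arcsine_fun_def
  proof (rule nn_integral_cong)
    fix x :: 'a
    show "(\<integral>\<^sup>+r\<in>{0<..}. ennreal (a r (norm (radial_map g x))) *
        indicator B (r *\<^sub>R (radial_map g x /\<^sub>R norm (radial_map g x))) \<partial>lborel)
        * indicator (- {0}) (radial_map g x) =
      (\<integral>\<^sup>+r\<in>{0<..}. ennreal (b r (norm x)) * indicator B (r *\<^sub>R (x /\<^sub>R norm x)) \<partial>lborel)
        * indicator (- {0}) x"
    proof (cases "x = 0")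
      case False
      then have "radial_map g x /\<^sub>R norm (radial_map g x) = x /\<^sub>R norm x"
        using sgn_radial_map[of g x] g_pos by (simp add: sgn_div_norm)
      with False show ?thesis
        using g_pos by (simp add: norm_radial_map radial_map_eq_0_iff ab)
    qed simp
  qed
  finally show ?thesis .
qed

text \<open>
  The domain and the transform depend on the set function only through its values on Borel sets,
  which is where the change of variables gives equality.
\<close>

lemma arcsine_range_radial_subset:
  assumes a: "case_prod a \<in> borel_measurable borel"
    and g: "g \<in> borel_measurable borel"
    and g_pos: "\<And>s. s > 0 \<Longrightarrow> g s > 0"
    and ab: "\<And>r s. s > 0 \<Longrightarrow> b r s = a r (g s)"
  shows "(arcsine_range b :: 'a::euclidean_space measure set) \<subseteq> arcsine_range a"
proof
  fix \<mu> :: "'a measure"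
  assume "\<mu> \<in> arcsine_range b"
  then obtain \<nu> :: "'a measure" where \<nu>: "\<nu> \<in> arcsine_domain b" and \<mu>: "\<mu> = arcsine_trans b \<nu>"
    by (auto simp: arcsine_range_def)
  from \<nu> have sets_\<nu>: "sets \<nu> = sets borel" and \<nu>_0: "emeasure \<nu> {0} = 0"
    and meas: "measure_space UNIV (sets borel) (arcsine_fun b \<nu>)"
    and levy: "arcsine_trans b \<nu> \<in> levy_measures"
    by (auto simp: arcsine_domain_def)
  define \<nu>' where "\<nu>' = distr \<nu> borel (radial_map g)"
  have eq: "arcsine_fun a \<nu>' B = arcsine_fun b \<nu> B" if "B \<in> sets borel" for B
    unfolding \<nu>'_def using sets_\<nu> a g g_pos ab that by (rule arcsine_fun_distr_radial_map)
  have sigma: "sigma_sets UNIV (sets borel) = sets (borel :: 'a measure)"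
    using sets.sigma_sets_eq[of "borel :: 'a measure"] by simp
  have "measure_space UNIV (sets borel) (arcsine_fun a \<nu>')"
    using meas eq measure_space_eq[of "sets borel" UNIV "arcsine_fun a \<nu>'" "arcsine_fun b \<nu>"]
    by (simp add: sigma)
  moreover have trans_eq: "arcsine_trans a \<nu>' = arcsine_trans b \<nu>"
    unfolding arcsine_trans_def using eq by (intro measure_of_eq) (simp_all add: sigma)
  moreover have "emeasure \<nu>' {0} = 0"
  proof -
    have "radial_map g -` {0} \<inter> space \<nu> = {0 :: 'a}"
      using sets_eq_imp_space_eq[OF sets_\<nu>] g_pos by (auto simp: radial_map_eq_0_iff)
    moreover have "radial_map g \<in> measurable \<nu> borel"
      using borel_measurable_radial_map[OF g] sets_\<nu> by (simp cong: measurable_cong_sets)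
    ultimately show ?thesis
      using \<nu>_0 by (simp add: \<nu>'_def emeasure_distr)
  qed
  ultimately have "\<nu>' \<in> arcsine_domain a"
    using levy by (simp add: arcsine_domain_def \<nu>'_def)
  with trans_eq \<mu> show "\<mu> \<in> arcsine_range a"
    by (auto simp: arcsine_range_def intro!: image_eqI[where x = \<nu>'])
qed

lemma borel_measurable_a1: "case_prod a1 \<in> borel_measurable borel"
proof -
  have "(\<lambda>p::real \<times> real. 2 / pi * (snd p - (fst p)\<^sup>2) powr (- 1 / 2) *
      of_bool (0 < fst p \<and> fst p < sqrt (snd p))) \<in> borel_measurable (borel \<Otimes>\<^sub>M borel)"
    by measurable
  then show ?thesis
    by (simp add: a1_def borel_prod split_beta' indicator_def)
qed

lemma borel_measurable_a2: "case_prod a2 \<in> borel_measurable borel"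
proof -
  have "(\<lambda>p::real \<times> real. 2 / pi * ((snd p)\<^sup>2 - (fst p)\<^sup>2) powr (- 1 / 2) *
      of_bool (0 < fst p \<and> fst p < snd p)) \<in> borel_measurable (borel \<Otimes>\<^sub>M borel)"
    by measurable
  then show ?thesis
    by (simp add: a2_def borel_prod split_beta' indicator_def)
qed

theorem proposition3p5:
  shows "(arcsine_range a1 :: (real ^ 'd) measure set) = arcsine_range a2"
proof
  show "(arcsine_range a1 :: (real ^ 'd) measure set) \<subseteq> arcsine_range a2"
    by (rule arcsine_range_radial_subset[where g = sqrt, OF borel_measurable_a2])
       (auto simp: a2_eq_a1)
  show "(arcsine_range a2 :: (real ^ 'd) measure set) \<subseteq> arcsine_range a1"
    by (rule arcsine_range_radial_subset[where g = "\<lambda>s. s\<^sup>2", OF borel_measurable_a1])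
       (auto simp: a2_eq_a1)
qed

end
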